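(* Let $h\ge 1$, $k\ge 1$ and $d\ge 0$ be integers. The set $SkYT_h(d+k,k)$ is in bijection with the set of permutations of length $d+k$ having exactly $d$ descents and satisfying the following property (called $DES_h$): for every $i\le h-1$, if one deletes $i$ elements of the permutation and renames the remaining elements in the usual way, the resulting permutation has precisely $d-i$ descents.
   Context: A descent of a permutation $\sigma=\sigma(1)\cdots\sigma(n)$ of $\{1,\dots,n\}$ is an index $j\in\{1,\dots,n-1\}$ with $\sigma(j)>\sigma(j+1)$. In property $DES_h$, $i$ is a nonnegative integer (the number of deleted elements), the deleted elements are arbitrary, and renaming the remaining elements in the usual way means replacing the remaining sequence by the order-isomorphic permutation. A Ferrers diagram of an integer partition $\lambda=(\lambda_1\ge\cdots\ge\lambda_k>0)$ is the left-justified array of cells with $\lambda_i$ cells in row $i$, rows numbered from top to bottom. A skew shape $\lambda\setminus\mu$ is the set of cells of the Ferrers diagram of $\lambda$ not lying in the Ferrers diagram of $\mu$ (with $\mu\subseteq\lambda$, both diagrams aligned at the top-left corner; $\mu_i=0$ for $i$ larger than the number of parts of $\mu$). Shapes are normalized so that the bottom row starts in the first column, i.e. $\mu_k=0$ where $k$ is the number of rows of $\lambda$, and every row is nonempty. A skew Young tableau of shape $\lambda\setminus\mu$ with $n$ cells is a filling of its cells with the integers $1,\dots,n$, each used once, strictly decreasing along each row (left to right) and along each column (top to bottom). For $h\ge 1$, $SkYT_h(n,k)$ denotes the set of skew Young tableaux having $n$ cells and $k$ rows such that any two consecutive rows have precisely $h$ columns in common (i.e. exactly $h$ columns contain a cell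 of both rows).
   Formalization: In DES_h only deletions leaving a nonempty permutation are considered (i less than the length); if the empty permutation with 0 descents were allowed, the claim would fail for k=1 and h≥d+2 (e.g. k=1, d=0, h=2); no other case is affected. *)

theory Defs
  imports Main "HOL-Library.FuncSet" "HOL-Combinatorics.Multiset_Permutations"
begin

section \<open>Skew shapes\<close>

definition is_partition :: "nat list \<Rightarrow> bool" where
  "is_partition lam \<longleftrightarrow> sorted_wrt (\<ge>) lam \<and> (\<forall>p\<in>set lam. 0 < p)"

text \<open>Cells are pairs (row, column), both counted from 0, rows from top to bottom.\<close>

definition ferrers :: "nat list \<Rightarrow> (nat \<times> nat) set" where
  "ferrers lam = {(i, j). i < length lam \<and> j < lam ! i}"

text \<open>Parts are positive, so \<open>length mu < k\<close> says that the k-th part of \<open>mu\<close> is 0, i.e. that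
  the bottom row starts in the first column.\<close>

definition skew_shape :: "nat \<Rightarrow> (nat \<times> nat) set \<Rightarrow> bool" where
  "skew_shape k S \<longleftrightarrow>
     (\<exists>lam mu. is_partition lam \<and> is_partition mu \<and> ferrers mu \<subseteq> ferrers lam \<and>
        length lam = k \<and> length mu < k \<and> S = ferrers lam - ferrers mu \<and>
        (\<forall>i<k. \<exists>j. (i, j) \<in> S))"

definition common_columns :: "(nat \<times> nat) set \<Rightarrow> nat \<Rightarrow> nat \<Rightarrow> nat set" where
  "common_columns S i i' = {j. (i, j) \<in> S \<and> (i', j) \<in> S}"


section \<open>Skew Young tableaux\<close>

definition tableau_filling :: "nat \<Rightarrow> (nat \<times> nat) set \<Rightarrow> (nat \<times> nat \<Rightarrow> nat) \<Rightarrow> bool" where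
  "tableau_filling n S T \<longleftrightarrow>
     T \<in> extensional S \<and> bij_betw T S {1..n} \<and>
     (\<forall>i j j'. (i, j) \<in> S \<longrightarrow> (i, j') \<in> S \<longrightarrow> j < j' \<longrightarrow> T (i, j) > T (i, j')) \<and>
     (\<forall>i i' j. (i, j) \<in> S \<longrightarrow> (i', j) \<in> S \<longrightarrow> i < i' \<longrightarrow> T (i, j) > T (i', j))"

text \<open>A tableau is a shape together with a filling of it. The filling is extensional, so that
  distinct pairs are distinct tableaux.\<close>

definition SkYT ::
  "nat \<Rightarrow> nat \<Rightarrow> nat \<Rightarrow> ((nat \<times> nat) set \<times> (nat \<times> nat \<Rightarrow> nat)) set" where
  "SkYT h n k = {(S, T). skew_shape k S \<and> card S = n \<and>
     (\<forall>i. Suc i < k \<longrightarrow> card (common_columns S i (Suc i)) = h) \<and> tableau_filling n S T}"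


section \<open>Permutations and descents\<close>

text \<open>Permutations of \<open>{1..n}\<close> are written in one-line notation, as the elements of
  \<open>permutations_of_set {1..n}\<close>; the paper's value at \<open>j\<close> is \<open>xs ! (j - 1)\<close>.\<close>

definition descents :: "nat list \<Rightarrow> nat set" where
  "descents xs = {j \<in> {1..<length xs}. xs ! (j - 1) > xs ! j}"

definition des :: "nat list \<Rightarrow> nat" where
  "des xs = card (descents xs)"

text \<open>For a list of distinct numbers, the order-isomorphic permutation: every entry is
  replaced by its rank, the smallest entry having rank 1.\<close>

definition standardize :: "nat list \<Rightarrow> nat list" where
  "standardize ys = map (\<lambda>y. card {z \<in> set ys. z \<le> y}) ys"

text \<open>The elements in the set of (0-based) positions \<open>D\<close> are deleted.\<close>

definition delete_positions :: "nat set \<Rightarrow> nat list \<Rightarrow> nat list" where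
  "delete_positions D xs = nths xs (- D)"

text \<open>The number of descents after deletion is compared with \<open>d - i\<close> in the integers: if
  \<open>d < i\<close>, the condition fails for every such deletion. The permutation that results from a
  deletion is required to be nonempty, hence \<open>i < length xs\<close>. Allowing the empty permutation
  (0 descents) would make the decreasing permutation of length \<open>d + 1\<close> violate the condition for
  \<open>h \<ge> d + 2\<close>, while the one-row tableau with \<open>d + 1\<close> cells has no consecutive rows to restrict.\<close>

definition DES :: "nat \<Rightarrow> nat \<Rightarrow> nat list \<Rightarrow> bool" where
  "DES h d xs \<longleftrightarrow>
     (\<forall>i D. i \<le> h - 1 \<longrightarrow> i < length xs \<longrightarrow> D \<subseteq> {..<length xs} \<longrightarrow> card D = i \<longrightarrow>
        int (des (standardize (delete_positions D xs))) = int d - int i)"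

end

theory Submission
  imports Defs
begin

text \<open>The bijection reads a tableau row by row, from the bottom row to the top row. Rows become
  decreasing runs. The first \<open>h\<close> cells of a row lie above the last \<open>h\<close> cells of the row below it,
  so the column condition makes the word ascend between rows: the rows are exactly the \<open>k\<close>
  maximal decreasing runs of the word, which hence has \<open>d\<close> descents.

  The position of a cell in this word is its column plus \<open>h\<close> times the number of rows below it,
  so vertical neighbours are exactly \<open>h\<close> positions apart. A word therefore is the reading word of
  a tableau if and only if two local conditions hold: the \<open>k\<close> runs have at least \<open>h\<close> entries
  each (unless there is only one run), and of two entries at distance at most \<open>h\<close> in different
  runs the right one is larger. For the shape this is \<open>shape_iff_run_profile\<close>, for the entries
  \<open>decreasing_filling_iff_layered\<close>.

  Property \<open>DES\<close> says that deleting fewer than \<open>h\<close> entries, but not all of them, preserves the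
  number of runs, for there are as many runs as there are entries that do not begin a descent. This amounts to the
  same local conditions (\<open>DES_iff_run_profile\<close>). After such a deletion any two neighbours were at
  distance at most \<open>h\<close> before, which gives one direction. For the other, deleting everything
  between two entries at distance at most \<open>h\<close>, or everything before or after an entry near one
  end of the word, tests each local condition separately.\<close>

section \<open>Descents, deletions and decreasing runs\<close>

lemma des_standardize: "des (standardize ys) = des ys"
proof -
  have rank: "card {z \<in> set ys. z \<le> b} < card {z \<in> set ys. z \<le> a} \<longleftrightarrow> b < a"
    if "a \<in> set ys" "b \<in> set ys" for a b
  proof
    assume "b < a"
    then have "{z \<in> set ys. z \<le> b} \<subset> {z \<in> set ys. z \<le> a}"
      using that by force
    then show "card {z \<in> set ys. z \<le> b} < card {z \<in> set ys. z \<le> a}"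
      by (simp add: psubset_card_mono)
  next
    assume less: "card {z \<in> set ys. z \<le> b} < card {z \<in> set ys. z \<le> a}"
    have "card {z \<in> set ys. z \<le> a} \<le> card {z \<in> set ys. z \<le> b}" if "a \<le> b"
      by (rule card_mono) (use that in auto)
    with less show "b < a" by (meson not_le)
  qed
  have "descents (standardize ys) = descents ys"
    by (auto simp: descents_def standardize_def rank)
  then show ?thesis by (simp add: des_def)
qed

lemma delete_positions_eq_map:
  "delete_positions D xs = map ((!) xs) (filter (\<lambda>p. p \<notin> D) [0..<length xs])"
proof -
  have "zip xs [0..<length xs] = map (\<lambda>p. (xs ! p, p)) [0..<length xs]"
    by (rule nth_equalityI) auto
  then show ?thesis
    by (simp add: delete_positions_def nths_def filter_map comp_def)
qed

lemma des_Nil [simp]: "des [] = 0" and des_single [simp]: "des [x] = 0"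
  by (simp_all add: des_def descents_def)

lemma des_Cons_Cons: "des (x # y # zs) = (if y < x then 1 else 0) + des (y # zs)"
proof -
  have eq: "descents (x # y # zs) = (if y < x then {1} else {}) \<union> Suc ` descents (y # zs)"
    (is "?A = ?B")
  proof (intro set_eqI)
    fix j
    show "j \<in> ?A \<longleftrightarrow> j \<in> ?B"
      by (cases j; cases "j - 1") (auto simp: descents_def nth_Cons')
  qed
  have "0 \<notin> descents (y # zs)" and "finite (descents (y # zs))"
    by (auto simp: descents_def)
  then show ?thesis
    by (auto simp: des_def eq card_image card_insert_if)
qed

lemma des_append:
  assumes "xs \<noteq> []" "ys \<noteq> []"
  shows "des (xs @ ys) = des xs + (if hd ys < last xs then 1 else 0) + des ys"
  using assms
proof (induction xs rule: induct_list012)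
  case (2 x)
  then show ?case by (cases ys) (auto simp: des_Cons_Cons)
qed (auto simp: des_Cons_Cons)

text \<open>The function \<open>r\<close> labels every entry with the number of the run that contains it. Where
  consecutive entries of a word do not descend, the label grows by one, so the number of these
  places is the difference between the last and the first label.\<close>

lemma des_telescope:
  fixes r :: "'a \<Rightarrow> nat"
  assumes "ps \<noteq> []"
    and "successively (\<lambda>u v. r v = r u + (if f v < f u then 0 else 1)) ps"
  shows "des (map f ps) + 1 + r (last ps) = length ps + r (hd ps)"
  using assms
  by (induction ps rule: induct_list012) (auto simp: des_Cons_Cons split: if_splits)

text \<open>The number of places up to position \<open>p\<close> where the word does not descend. The maximal
  decreasing runs of the word are thereby numbered from 0, and \<open>p\<close> lies in run number
  \<open>run_index xs p\<close>.\<close>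

definition run_index :: "nat list \<Rightarrow> nat \<Rightarrow> nat" where
  "run_index xs p = card ({1..p} - descents xs)"

lemma run_index_0 [simp]: "run_index xs 0 = 0"
  by (simp add: run_index_def)

lemma run_index_Suc:
  assumes "Suc p < length xs"
  shows "run_index xs (Suc p) = run_index xs p + (if xs ! Suc p < xs ! p then 0 else 1)"
proof -
  have "{1..Suc p} - descents xs
      = (if xs ! Suc p < xs ! p then {} else {Suc p}) \<union> ({1..p} - descents xs)"
    using assms by (auto simp: descents_def le_Suc_eq)
  then show ?thesis by (simp add: run_index_def)
qed

lemma run_index_mono: "u \<le> v \<Longrightarrow> run_index xs u \<le> run_index xs v"
  unfolding run_index_def by (intro card_mono) auto

lemma des_segment:
  assumes "a < b" "b \<le> length xs"
  shows "des (map ((!) xs) [a..<b]) + 1 + run_index xs (b - 1) = b - a + run_index xs a"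
proof -
  have "successively (\<lambda>u v. run_index xs v = run_index xs u + (if xs ! v < xs ! u then 0 else 1)) [a..<b]"
    using assms by (auto simp: successively_conv_nth run_index_Suc)
  from des_telescope[OF _ this] show ?thesis
    using assms by (simp add: last_upt)
qed

lemma run_index_last:
  assumes "xs \<noteq> []"
  shows "des xs + 1 + run_index xs (length xs - 1) = length xs"
  using des_segment[of 0 "length xs" xs] assms by (simp add: map_nth)

lemma upt_split: "a \<le> b \<Longrightarrow> b \<le> c \<Longrightarrow> [a..<c] = [a..<b] @ [b..<c]"
  using upt_add_eq_append[of a b "c - b"] by simp

text \<open>Run numbers of the positions \<open>0, \<dots>, n - 1\<close> for which each of the \<open>k\<close> runs has at least
  \<open>h\<close> entries, provided that there are at least two runs: two positions at distance at most \<open>h\<close>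
  lie in the same run or in adjacent ones, and the first and the last \<open>h\<close> positions lie in the
  first and the last run. If \<open>0 < n \<le> h\<close>, the last two conditions speak of all positions and force
  \<open>k = 1\<close>.\<close>

definition run_profile :: "nat \<Rightarrow> nat \<Rightarrow> nat \<Rightarrow> (nat \<Rightarrow> nat) \<Rightarrow> bool" where
  "run_profile h k n r \<longleftrightarrow>
     (\<forall>u v. u \<le> v \<longrightarrow> v < n \<longrightarrow> r u \<le> r v) \<and>
     (\<forall>u v. u \<le> v \<longrightarrow> v \<le> u + h \<longrightarrow> v < n \<longrightarrow> r v \<le> Suc (r u)) \<and>
     (\<forall>p<n. p < h \<longrightarrow> r p = 0) \<and>
     (\<forall>p<n. n \<le> p + h \<longrightarrow> Suc (r p) = k)"

text \<open>At distance at most \<open>h\<close>, the larger of two values stands to the left exactly if both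
  stand in the same run. For a profile, distinct entries and positive \<open>h\<close>, this says that the
  runs decrease and that an entry is smaller than every entry of the next run at distance at
  most \<open>h\<close>.\<close>

definition layered :: "nat \<Rightarrow> (nat \<Rightarrow> nat) \<Rightarrow> nat list \<Rightarrow> bool" where
  "layered h r xs \<longleftrightarrow>
     (\<forall>u v. u < v \<longrightarrow> v \<le> u + h \<longrightarrow> v < length xs \<longrightarrow> (xs ! v < xs ! u \<longleftrightarrow> r v = r u))"

lemma strictly_between_neighbours:
  fixes ps :: "nat list"
  assumes "sorted_wrt (<) ps" "Suc j < length ps" "ps ! j < x" "x < ps ! Suc j"
  shows "x \<notin> set ps"
proof
  assume "x \<in> set ps"
  then obtain i where i: "i < length ps" "x = ps ! i"
    by (auto simp: in_set_conv_nth)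
  have mono: "ps ! a < ps ! b" if "a < b" "b < length ps" for a b
    using assms(1) that by (rule sorted_wrt_nth_less)
  consider "i < j" | "i = j" | "i = Suc j" | "Suc j < i" by linarith
  then show False
    using assms(2-4) i mono[of i j] mono[of "Suc j" i] by cases auto
qed

text \<open>With fewer than \<open>h\<close> deletions, neighbours in the remaining word were at distance at most
  \<open>h\<close>. So \<open>layered\<close> still decides by run numbers whether they descend, the first remaining entry
  belongs to the first run and the last one to the last run. Telescoping then gives the number
  of descents.\<close>

lemma des_delete_positions:
  assumes r: "run_profile h k (length xs) r" and lay: "layered h r xs"
    and D: "D \<subseteq> {..<length xs}" "card D < h" "card D < length xs"
  shows "des (delete_positions D xs) + k = length xs - card D"
proof -
  define n where "n = length xs"
  define ps where "ps = filter (\<lambda>p. p \<notin> D) [0..<n]"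
  have finD: "finite D" using D(1) finite_subset by blast
  have set_ps: "set ps = {..<n} - D" by (auto simp: ps_def)
  have sorted: "sorted_wrt (<) ps"
    by (simp add: ps_def sorted_wrt_filter)
  have "distinct ps" by (simp add: ps_def)
  then have len: "length ps = n - card D"
    using D(1) finD by (simp add: distinct_card[symmetric] set_ps card_Diff_subset n_def)
  have ne: "ps \<noteq> []" using len D(3) n_def by auto
  have short: "b \<le> a + card D" if "{a..<b} \<subseteq> D" for a b :: nat
    using card_mono[OF finD that] by simp
  have mono: "r u \<le> r v" if "u \<le> v" "v < n" for u v
    using r that by (auto simp: run_profile_def n_def)
  have jump: "r v \<le> Suc (r u)" if "u \<le> v" "v \<le> u + h" "v < n" for u v
    using r that by (auto simp: run_profile_def n_def)
  have steps: "successively (\<lambda>u v. r v = r u + (if xs ! v < xs ! u then 0 else 1)) ps"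
    unfolding successively_conv_nth
  proof (intro allI impI)
    fix j assume j: "Suc j < length ps"
    let ?u = "ps ! j" and ?v = "ps ! Suc j"
    have uv: "?u < ?v" using sorted j by (intro sorted_wrt_nth_less) auto
    have v: "?v < n" using set_ps j nth_mem[of "Suc j" ps] by auto
    have "{Suc ?u..<?v} \<subseteq> D"
    proof
      fix x assume x: "x \<in> {Suc ?u..<?v}"
      then have "x \<notin> set ps"
        using strictly_between_neighbours[OF sorted j] by auto
      with x v show "x \<in> D" by (auto simp: set_ps)
    qed
    from short[OF this] have near: "?v \<le> ?u + h" using D(2) by simp
    have "xs ! ?v < xs ! ?u \<longleftrightarrow> r ?v = r ?u"
      using lay uv near v by (auto simp: layered_def n_def)
    moreover have "r ?u \<le> r ?v" "r ?v \<le> Suc (r ?u)"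
      using mono jump uv near v by auto
    ultimately show "r ?v = r ?u + (if xs ! ?v < xs ! ?u then 0 else 1)"
      by auto
  qed
  have hd_least: "hd ps \<le> p" if "p \<in> set ps" for p
    using sorted ne that by (cases ps) auto
  have last_greatest: "p \<le> last ps" if "p \<in> set ps" for p
    using sorted ne that by (cases ps rule: rev_cases) (auto simp: sorted_wrt_append)
  have hd_in: "hd ps < n" and last_in: "last ps < n"
    using set_ps ne hd_in_set[OF ne] last_in_set[OF ne] by auto
  have "{0..<hd ps} \<subseteq> D"
  proof
    fix x assume "x \<in> {0..<hd ps}"
    then have "x \<notin> set ps" "x < n" using hd_least[of x] hd_in by auto
    then show "x \<in> D" by (auto simp: set_ps)
  qed
  from short[OF this] have "r (hd ps) = 0"
    using r hd_in D(2) by (auto simp: run_profile_def n_def)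
  moreover have "{Suc (last ps)..<n} \<subseteq> D"
  proof
    fix x assume "x \<in> {Suc (last ps)..<n}"
    then have "x \<notin> set ps" "x < n" using last_greatest[of x] by auto
    then show "x \<in> D" by (auto simp: set_ps)
  qed
  from short[OF this] have "Suc (r (last ps)) = k"
    using r last_in D(2) by (auto simp: run_profile_def n_def)
  ultimately show ?thesis
    using des_telescope[OF ne steps] len
    by (simp add: delete_positions_eq_map ps_def n_def)
qed

text \<open>For the direction from \<open>DES\<close> to the local conditions, it suffices to delete intervals.
  Deleting the \<open>p < h\<close> entries before position \<open>p\<close> must preserve the number of runs, so \<open>p\<close> is in
  the first run; likewise at the end. Deleting all entries strictly between \<open>u\<close> and \<open>v\<close> makes
  them neighbours, and the number of runs is preserved only if they descend when \<open>u\<close> and \<open>v\<close> are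
  in the same run and ascend, from one run to the next, otherwise.\<close>

lemma DES_iff_run_profile:
  assumes len: "length xs = d + k" and des: "des xs = d" and h: "h \<ge> 1" and k: "k \<ge> 1"
  shows "DES h d xs \<longleftrightarrow> run_profile h k (d + k) (run_index xs) \<and> layered h (run_index xs) xs"
    (is "_ \<longleftrightarrow> run_profile h k _ ?r \<and> _")
proof
  assume "run_profile h k (d + k) ?r \<and> layered h ?r xs"
  then have "des (delete_positions D xs) + k = d + k - card D"
    if "card D \<le> h - 1" "card D < length xs" "D \<subseteq> {..<length xs}" for D
    using des_delete_positions[of h k xs ?r D] that h len by auto
  then show "DES h d xs"
    unfolding DES_def des_standardize
    using len by (smt (verit, del_insts) diff_add_inverse2 less_imp_le_nat
        of_nat_add of_nat_diff)
next
  assume DES: "DES h d xs"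
  have del: "des (map ((!) xs) (filter (\<lambda>p. p \<notin> D) [0..<d + k])) + card D = d"
    if "card D < h" "card D < d + k" "D \<subseteq> {..<d + k}" for D
  proof -
    have "int (des (standardize (delete_positions D xs))) = int d - int (card D)"
      using DES that len unfolding DES_def by auto
    then show ?thesis unfolding des_standardize delete_positions_eq_map len by linarith
  qed
  have last: "Suc (?r (d + k - 1)) = k"
    using run_index_last[of xs] len des k by fastforce
  have first_run: "?r p = 0" if p: "p < d + k" "p < h" for p
  proof -
    have "[0..<d + k] = [0..<p] @ [p..<d + k]"
      using p by (intro upt_split) auto
    then have "filter (\<lambda>q. q \<notin> {..<p}) [0..<d + k] = [p..<d + k]"
      by simp
    with del[of "{..<p}"] p have "des (map ((!) xs) [p..<d + k]) + p = d"
      by auto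
    with des_segment[of p "d + k" xs] p len last show ?thesis by simp
  qed
  have last_run: "Suc (?r p) = k" if p: "p < d + k" "d + k \<le> p + h" for p
  proof -
    have "[0..<d + k] = [0..<Suc p] @ [Suc p..<d + k]"
      using p by (intro upt_split) auto
    then have "filter (\<lambda>q. q \<notin> {Suc p..<d + k}) [0..<d + k] = [0..<Suc p]"
      by (simp del: upt_Suc)
    moreover have "{Suc p..<d + k} \<subseteq> {..<d + k}" by auto
    ultimately have "des (map ((!) xs) [0..<Suc p]) + (d + k - Suc p) = d"
      using del[of "{Suc p..<d + k}"] p by (simp del: upt_Suc)
    with des_segment[of 0 "Suc p" xs] p len show ?thesis by (simp del: upt_Suc)
  qed
  have near: "?r v = ?r u + (if xs ! v < xs ! u then 0 else 1)"
    if uv: "u < v" "v \<le> u + h" "v < d + k" for u v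
  proof -
    have "[0..<d + k] = [0..<Suc u] @ [Suc u..<v] @ [v..<d + k]"
      using uv upt_split[of 0 "Suc u" "d + k"] upt_split[of "Suc u" v "d + k"] by simp
    then have "filter (\<lambda>q. q \<notin> {Suc u..<v}) [0..<d + k] = [0..<Suc u] @ [v..<d + k]"
      using uv by (simp del: upt_Suc)
    moreover have "{Suc u..<v} \<subseteq> {..<d + k}" using uv by auto
    ultimately have "des (map ((!) xs) [0..<Suc u] @ map ((!) xs) [v..<d + k]) + (v - Suc u) = d"
      using del[of "{Suc u..<v}"] uv by (simp del: upt_Suc)
    moreover have "[v..<d + k] \<noteq> []" "hd (map ((!) xs) [v..<d + k]) = xs ! v"
      using uv by (simp_all add: upt_conv_Cons)
    ultimately have "des (map ((!) xs) [0..<Suc u]) + (if xs ! v < xs ! u then 1 else 0)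
        + des (map ((!) xs) [v..<d + k]) + (v - Suc u) = d"
      by (subst (asm) des_append) simp_all
    with des_segment[of 0 "Suc u" xs] des_segment[of v "d + k" xs] uv len last show ?thesis
      by (auto simp del: upt_Suc split: if_splits)
  qed
  have "?r v \<le> Suc (?r u)" if "u \<le> v" "v \<le> u + h" "v < d + k" for u v
    using near[of u v] that by (cases "u = v") auto
  then have "run_profile h k (d + k) ?r"
    using first_run last_run run_index_mono by (auto simp: run_profile_def)
  moreover have "layered h ?r xs"
    using near len by (auto simp: layered_def split: if_splits)
  ultimately show "run_profile h k (d + k) ?r \<and> layered h ?r xs" ..
qed

section \<open>Shapes with prescribed overlaps\<close>

lemma antimono_upto:
  fixes m :: "nat \<Rightarrow> nat"
  assumes "\<And>i. Suc i < k \<Longrightarrow> m (Suc i) \<le> m i" and "i \<le> i'" "i' < k"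
  shows "m i' \<le> m i"
  using assms(2,3)
proof (induction i' rule: dec_induct)
  case (step j)
  then show ?case using assms(1)[of j] by simp
qed simp

text \<open>A partition has positive parts only, so the parts of a weakly decreasing function are cut
  off at the first zero; this does not change the diagram.\<close>

lemma partition_of_antimono:
  fixes m :: "nat \<Rightarrow> nat"
  assumes dec: "\<And>i. Suc i < k \<Longrightarrow> m (Suc i) \<le> m i"
  defines "mu \<equiv> takeWhile (\<lambda>x. 0 < x) (map m [0..<k])"
  shows "is_partition mu" and "ferrers mu = {(i, j). i < k \<and> j < m i}"
proof -
  have anti: "m i' \<le> m i" if "i \<le> i'" "i' < k" for i i'
    using antimono_upto[of k m] dec that by blast
  have len: "length mu \<le> k"
    unfolding mu_def by (metis length_map length_takeWhile_le length_upt minus_nat.diff_0)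
  have nth: "mu ! i = m i" if "i < length mu" for i
    using that len unfolding mu_def by (simp add: takeWhile_nth)
  have "\<forall>p\<in>set mu. 0 < p"
    using set_takeWhileD unfolding mu_def by metis
  moreover have "sorted_wrt (\<ge>) mu"
    using len by (auto simp: sorted_wrt_iff_nth_less nth intro!: anti)
  ultimately show "is_partition mu" by (simp add: is_partition_def)
  have "i < length mu" if "i < k" "0 < m i" for i
  proof (rule ccontr)
    assume "\<not> i < length mu"
    then have le: "length mu \<le> i" by simp
    then have "\<not> 0 < m (length mu)"
      using nth_length_takeWhile[of "\<lambda>x. 0 < x" "map m [0..<k]"] that
      unfolding mu_def by simp
    with anti[OF le] that show False by simp
  qed
  then show "ferrers mu = {(i, j). i < k \<and> j < m i}"
    using len nth by (fastforce simp: ferrers_def)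
qed

text \<open>Row \<open>i\<close> of a skew shape is the interval of columns from \<open>a i\<close> to \<open>b i - 1\<close>. Functions on row
  indices spare the distinction between parts of the inner partition and the rows beyond its
  last part.\<close>

lemma skew_shape_iff:
  "skew_shape k S \<longleftrightarrow> 0 < k \<and>
     (\<exists>a b. (\<forall>i. Suc i < k \<longrightarrow> a (Suc i) \<le> a i \<and> b (Suc i) \<le> b i) \<and>
        (\<forall>i<k. a i < b i) \<and> a (k - 1) = 0 \<and>
        S = {(i, j). i < k \<and> a i \<le> j \<and> j < b i})"
    (is "_ \<longleftrightarrow> 0 < k \<and> (\<exists>a b. ?dec a b \<and> ?nonempty a b \<and> ?bottom a \<and> ?S a b)")
proof
  assume "skew_shape k S"
  then obtain lam mu where lam: "is_partition lam" and mu: "is_partition mu"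
    and k: "length lam = k" "length mu < k" and S: "S = ferrers lam - ferrers mu"
    and rows: "\<forall>i<k. \<exists>j. (i, j) \<in> S"
    by (auto simp: skew_shape_def)
  let ?a = "\<lambda>i. if i < length mu then mu ! i else 0"
  have "?S ?a ((!) lam)"
    using k by (auto simp: S ferrers_def)
  moreover have "?nonempty ?a ((!) lam)"
  proof (intro allI impI)
    fix i assume i: "i < k"
    then obtain j where "(i, j) \<in> S" using rows by blast
    then show "?a i < lam ! i" by (auto simp: S ferrers_def split: if_splits)
  qed
  moreover have "?dec ?a ((!) lam)"
    using lam mu k by (auto simp: is_partition_def sorted_wrt_iff_nth_less)
  moreover have "?bottom ?a" using k by auto
  moreover have "0 < k" using k by simp
  ultimately show "0 < k \<and> (\<exists>a b. ?dec a b \<and> ?nonempty a b \<and> ?bottom a \<and> ?S a b)"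
    by (intro conjI exI[of _ ?a] exI[of _ "(!) lam"])
next
  assume "0 < k \<and> (\<exists>a b. ?dec a b \<and> ?nonempty a b \<and> ?bottom a \<and> ?S a b)"
  then obtain a b where k: "0 < k" and dec: "?dec a b" and nonempty: "?nonempty a b"
    and bottom: "?bottom a" and S: "?S a b"
    by blast
  define mu where "mu = takeWhile (\<lambda>x. 0 < x) (map a [0..<k])"
  have mu: "is_partition mu" "ferrers mu = {(i, j). i < k \<and> j < a i}"
    unfolding mu_def using dec by (intro partition_of_antimono; blast)+
  have "length mu \<noteq> k"
  proof
    assume "length mu = k"
    then have "(k - 1, 0) \<in> ferrers mu"
      using k mu(1) by (auto simp: ferrers_def is_partition_def)
    then show False using mu(2) bottom by simp
  qed
  moreover have "length mu \<le> k"
    unfolding mu_def by (metis length_map length_takeWhile_le length_upt minus_nat.diff_0)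
  ultimately have len_mu: "length mu < k" by simp
  have "b i' \<le> b i" if "i < i'" "i' < k" for i i'
    using antimono_upto[of k b i i'] dec that by auto
  moreover have "\<forall>i<k. 0 < b i" using nonempty by (metis gr_zeroI not_less0)
  ultimately have lam: "is_partition (map b [0..<k])"
    by (auto simp: is_partition_def sorted_wrt_iff_nth_less)
  have "ferrers (map b [0..<k]) = {(i, j). i < k \<and> j < b i}"
    by (auto simp: ferrers_def)
  then have "S = ferrers (map b [0..<k]) - ferrers mu"
      "ferrers mu \<subseteq> ferrers (map b [0..<k])"
    using S mu(2) nonempty by fastforce+
  moreover have "\<forall>i<k. \<exists>j. (i, j) \<in> S" using nonempty S by auto
  ultimately show "skew_shape k S"
    unfolding skew_shape_def using lam mu(1) len_mu
    by (intro exI[of _ "map b [0..<k]"] exI[of _ mu]) simp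
qed

text \<open>\<open>B s\<close> is the position where run \<open>s\<close> begins, and \<open>B k\<close> is the length of the word. A single
  run may be shorter than \<open>h\<close>.\<close>

definition run_starts :: "nat \<Rightarrow> nat \<Rightarrow> (nat \<Rightarrow> nat) \<Rightarrow> bool" where
  "run_starts h k B \<longleftrightarrow>
     B 0 = 0 \<and> (\<forall>s<k. B s < B (Suc s)) \<and> (k > 1 \<longrightarrow> (\<forall>s<k. B s + h \<le> B (Suc s)))"

text \<open>The reading word of a tableau lists its rows from bottom to top, so run \<open>s\<close> fills row
  \<open>k - Suc s\<close>. Going along a row, the column and the position grow together; going from the end of
  a row to the start of the next row above, the column drops by \<open>h - 1\<close> while the position grows
  by one. Hence position \<open>p\<close> of run \<open>s\<close> has column \<open>p - h * s\<close>.\<close>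

definition stacked_runs :: "nat \<Rightarrow> nat \<Rightarrow> (nat \<Rightarrow> nat) \<Rightarrow> (nat \<times> nat) set" where
  "stacked_runs h k B = {(k - Suc s, p - h * s) | s p. s < k \<and> B s \<le> p \<and> p < B (Suc s)}"

text \<open>The same arrangement of cells, indexed by the positions of the word.\<close>

definition cell :: "nat \<Rightarrow> nat \<Rightarrow> (nat \<Rightarrow> nat) \<Rightarrow> nat \<Rightarrow> nat \<times> nat" where
  "cell h k r p = (k - Suc (r p), p - h * r p)"

lemma run_starts_mono:
  assumes "run_starts h k B" "s \<le> t" "t \<le> k"
  shows "B s \<le> B t"
  using assms(2,3)
proof (induction t rule: dec_induct)
  case (step t)
  have "B t < B (Suc t)" using assms(1) step by (auto simp: run_starts_def)
  then show ?case using step by simp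
qed simp

text \<open>The truncated subtractions \<open>p - h * s\<close> in \<open>stacked_runs\<close> are therefore true ones.\<close>

lemma run_starts_ge:
  assumes "run_starts h k B" "s < k"
  shows "h * s \<le> B s"
  using assms(2)
proof (induction s)
  case (Suc s)
  then have "B s + h \<le> B (Suc s)" using assms(1) by (auto simp: run_starts_def)
  then show ?case using Suc by simp
qed simp

text \<open>The common columns of rows \<open>i\<close> and \<open>i + 1\<close> are those from \<open>a i\<close> to \<open>b (i + 1) - 1\<close>. As
  \<open>h\<close> is positive, having \<open>h\<close> of them means \<open>b (i + 1) = a i + h\<close>, which is to say that the runs
  follow each other without gap once row \<open>i\<close> is shifted to the right by \<open>h * (k - Suc i)\<close>. Each row
  that has a neighbour contains the \<open>h\<close> columns shared with it, hence has length at least \<open>h\<close>; this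
  length condition is in turn what makes both boundaries monotone.\<close>

lemma overlapping_shape_iff:
  assumes "h \<ge> 1" "k \<ge> 1"
  shows "skew_shape k S \<and> (\<forall>i. Suc i < k \<longrightarrow> card (common_columns S i (Suc i)) = h)
     \<longleftrightarrow> (\<exists>B. run_starts h k B \<and> S = stacked_runs h k B)" (is "?L \<longleftrightarrow> ?R")
proof
  assume L: ?L
  then obtain a b where dec: "\<forall>i. Suc i < k \<longrightarrow> a (Suc i) \<le> a i \<and> b (Suc i) \<le> b i"
    and nonempty: "\<forall>i<k. a i < b i" and bottom: "a (k - 1) = (0::nat)"
    and S: "S = {(i, j). i < k \<and> a i \<le> j \<and> j < b i}"
    by (auto simp: skew_shape_iff)
  have overlap: "b (Suc i) = a i + h" if "Suc i < k" for i
  proof -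
    have "a (Suc i) \<le> a i" "b (Suc i) \<le> b i" using dec that by auto
    then have "common_columns S i (Suc i) = {a i..<b (Suc i)}"
      using that by (auto simp: common_columns_def S)
    moreover have "card (common_columns S i (Suc i)) = h" using L that by blast
    ultimately show ?thesis using \<open>h \<ge> 1\<close> by simp
  qed
  \<comment> \<open>Run \<open>s\<close> begins where run \<open>s - 1\<close>, which is row \<open>k - s\<close>, ends; this also covers \<open>s = k\<close>.\<close>
  define B where "B s = (if s = 0 then 0 else b (k - s) + h * (s - 1))" for s
  have B: "B s = a (k - Suc s) + h * s" if s: "s < k" for s
  proof (cases s)
    case 0
    then show ?thesis using bottom by (simp add: B_def)
  next
    case (Suc t)
    have "b (Suc (k - Suc s)) = a (k - Suc s) + h"
      by (rule overlap) (use s Suc in auto)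
    moreover have "Suc (k - Suc s) = k - s" using s by simp
    ultimately show ?thesis using Suc by (simp add: B_def)
  qed
  have B': "B (Suc s) = b (k - Suc s) + h * s" for s
    by (simp add: B_def)
  have "B s + h \<le> B (Suc s)" if s: "s < k" "k > 1" for s
  proof (cases s)
    case 0
    have "b (Suc (k - 2)) = a (k - 2) + h" by (rule overlap) (use s in auto)
    moreover have "Suc (k - 2) = k - 1" using s by simp
    ultimately show ?thesis using 0 bottom B[of 0] B'[of 0] s by simp
  next
    case (Suc t)
    have "Suc (k - Suc s) = k - s" using s by simp
    then have "b (k - s) = a (k - Suc s) + h" "b (k - s) \<le> b (k - Suc s)"
      using overlap[of "k - Suc s"] dec[rule_format, of "k - Suc s"] s Suc by auto
    then show ?thesis using s Suc by (simp add: B B')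
  qed
  then have "run_starts h k B"
    using nonempty by (auto simp: run_starts_def B B' B_def[of 0])
  moreover have "S = stacked_runs h k B"
  proof (intro set_eqI)
    fix c :: "nat \<times> nat"
    obtain i j where c: "c = (i, j)" by (cases c)
    show "c \<in> S \<longleftrightarrow> c \<in> stacked_runs h k B"
    proof
      assume "c \<in> S"
      then have "i < k" "a i \<le> j" "j < b i" by (auto simp: S c)
      then show "c \<in> stacked_runs h k B"
        unfolding stacked_runs_def c
        by (intro CollectI exI[of _ "k - Suc i"] exI[of _ "j + h * (k - Suc i)"])
          (auto simp: B B')
    next
      assume "c \<in> stacked_runs h k B"
      then show "c \<in> S" by (auto simp: stacked_runs_def S c B B')
    qed
  qed
  ultimately show ?R by blast
next
  assume ?R
  then obtain B where B: "run_starts h k B" and S: "S = stacked_runs h k B" by blast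
  define a where "a i = B (k - Suc i) - h * (k - Suc i)" for i
  define b where "b i = B (Suc (k - Suc i)) - h * (k - Suc i)" for i
  have ge: "h * (k - Suc i) \<le> B (k - Suc i)" for i
    using run_starts_ge[OF B, of "k - Suc i"] \<open>k \<ge> 1\<close> by simp
  have lt: "B (k - Suc i) < B (Suc (k - Suc i))" for i
    using B \<open>k \<ge> 1\<close> by (simp add: run_starts_def)
  have S': "S = {(i, j). i < k \<and> a i \<le> j \<and> j < b i}"
  proof (intro set_eqI)
    fix c :: "nat \<times> nat"
    obtain i j where c: "c = (i, j)" by (cases c)
    show "c \<in> S \<longleftrightarrow> c \<in> {(i, j). i < k \<and> a i \<le> j \<and> j < b i}"
    proof
      assume "c \<in> S"
      then obtain s p where sp: "s < k" "B s \<le> p" "p < B (Suc s)" "i = k - Suc s" "j = p - h * s"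
        by (auto simp: S c stacked_runs_def)
      moreover have "k - Suc i = s" using sp by simp
      moreover have "h * s \<le> B s" using run_starts_ge[OF B] sp by simp
      ultimately show "c \<in> {(i, j). i < k \<and> a i \<le> j \<and> j < b i}"
        by (auto simp: c a_def b_def)
    next
      assume "c \<in> {(i, j). i < k \<and> a i \<le> j \<and> j < b i}"
      then show "c \<in> S"
        unfolding S stacked_runs_def c
        by (intro CollectI exI[of _ "k - Suc i"] exI[of _ "j + h * (k - Suc i)"])
          (auto simp: a_def b_def)
    qed
  qed
  have step: "a (Suc i) \<le> a i \<and> b (Suc i) \<le> b i \<and> b (Suc i) = a i + h" if i: "Suc i < k" for i
  proof -
    define s where "s = k - Suc (Suc i)"
    have s: "k - Suc i = Suc s" "Suc s < k" "k > 1" using i by (auto simp: s_def)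
    have "B s + h \<le> B (Suc s)" "B (Suc s) + h \<le> B (Suc (Suc s))"
      using B s by (auto simp: run_starts_def)
    moreover have "h * Suc s \<le> B (Suc s)" "h * s \<le> B s"
      using run_starts_ge[OF B, of s] run_starts_ge[OF B, of "Suc s"] s(2) by auto
    ultimately show ?thesis
      unfolding a_def b_def s(1) s_def[symmetric] mult_Suc_right by linarith
  qed
  have rows: "\<forall>i<k. a i < b i"
    using lt ge by (auto simp: a_def b_def intro!: diff_less_mono)
  have "a (k - 1) = 0" using B \<open>k \<ge> 1\<close> by (simp add: a_def run_starts_def)
  moreover have "\<forall>i. Suc i < k \<longrightarrow> a (Suc i) \<le> a i \<and> b (Suc i) \<le> b i" using step by blast
  moreover have "0 < k" using \<open>k \<ge> 1\<close> by simp
  ultimately have "skew_shape k S"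
    unfolding skew_shape_iff using rows S' by (intro conjI exI[of _ a] exI[of _ b])
  moreover have "card (common_columns S i (Suc i)) = h" if i: "Suc i < k" for i
  proof -
    have "common_columns S i (Suc i) = {a i..<b (Suc i)}"
      using i step[OF i] by (auto simp: common_columns_def S')
    then show ?thesis using step[OF i] by simp
  qed
  ultimately show ?L by blast
qed

text \<open>Run starts and run numbers determine each other: the run of \<open>p\<close> is the first one that ends
  after \<open>p\<close>, and conversely run \<open>s\<close> begins at the number of positions in earlier runs.\<close>

lemma run_profile_of_starts:
  assumes B: "run_starts h k B" and k: "k \<ge> 1"
  obtains r where "run_profile h k (B k) r" "stacked_runs h k B = cell h k r ` {..<B k}"
proof
  define r where "r p = (LEAST s. p < B (Suc s))" for p
  have r: "r p < k" "B (r p) \<le> p" "p < B (Suc (r p))" if p: "p < B k" for p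
  proof -
    have ex: "p < B (Suc (k - 1))" using p k by simp
    show "p < B (Suc (r p))" unfolding r_def by (rule LeastI) (rule ex)
    have "r p \<le> k - 1" unfolding r_def by (rule Least_le) (rule ex)
    then show "r p < k" using k by simp
    show "B (r p) \<le> p"
    proof (cases "r p")
      case 0
      then show ?thesis using B by (simp add: run_starts_def)
    next
      case (Suc s)
      then have "\<not> p < B (Suc s)" unfolding r_def by (intro not_less_Least) simp
      then show ?thesis using Suc by simp
    qed
  qed
  note mono = run_starts_mono[OF B]
  have gap: "B s + h \<le> B (Suc s)" if "s < k" "k > 1" for s
    using B that by (auto simp: run_starts_def)
  show "run_profile h k (B k) r"
    unfolding run_profile_def
  proof (intro conjI allI impI)
    fix u v assume "u \<le> v" "v < B k"
    then have "u < B (Suc (r v))" using r(3)[of v] by simp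
    then show "r u \<le> r v" unfolding r_def[of u] by (rule Least_le)
  next
    fix u v :: nat assume v: "u \<le> v" "v \<le> u + h" "v < B k"
    show "r v \<le> Suc (r u)"
    proof (rule ccontr)
      assume "\<not> r v \<le> Suc (r u)"
      then have far: "Suc (Suc (r u)) \<le> r v" by simp
      then have "B (Suc (Suc (r u))) \<le> B (r v)" using r(1)[of v] v by (intro mono) auto
      moreover have "B (Suc (r u)) + h \<le> B (Suc (Suc (r u)))"
        using far r(1)[of v] v by (intro gap) auto
      ultimately show False using r(2)[of v] r(3)[of u] v by simp
    qed
  next
    fix p assume p: "p < B k" "p < h"
    show "r p = 0"
    proof (rule ccontr)
      assume "r p \<noteq> 0"
      then have "B 1 \<le> B (r p)" "B 0 + h \<le> B (Suc 0)"
        using r(1)[of p] p by (auto intro!: mono gap)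
      then show False using r(2)[of p] p by simp
    qed
  next
    fix p assume p: "p < B k" "B k \<le> p + h"
    show "Suc (r p) = k"
    proof (rule ccontr)
      assume "Suc (r p) \<noteq> k"
      then have "Suc (r p) < k" using r(1)[of p] p by simp
      then have "B (Suc (r p)) + h \<le> B (Suc (Suc (r p)))" "B (Suc (Suc (r p))) \<le> B k"
        by (auto intro!: mono gap)
      then show False using r(3)[of p] p by simp
    qed
  qed
  show "stacked_runs h k B = cell h k r ` {..<B k}"
  proof (intro equalityI subsetI)
    fix c assume "c \<in> stacked_runs h k B"
    then obtain s p where sp: "s < k" "B s \<le> p" "p < B (Suc s)" "c = (k - Suc s, p - h * s)"
      by (auto simp: stacked_runs_def)
    have p: "p < B k" using mono[of "Suc s" k] sp by simp
    have "r p = s"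
    proof (rule antisym)
      show "r p \<le> s" unfolding r_def by (rule Least_le) (rule sp)
      show "s \<le> r p"
        using r(3)[OF p] sp mono[of "Suc (r p)" s] by (meson leD le_less_trans not_less_eq_eq order_trans less_imp_le)
    qed
    then show "c \<in> cell h k r ` {..<B k}" using p sp by (auto simp: cell_def)
  next
    fix c assume "c \<in> cell h k r ` {..<B k}"
    then show "c \<in> stacked_runs h k B"
      using r by (force simp: cell_def stacked_runs_def)
  qed
qed

text \<open>Going back by \<open>h\<close> positions lowers the run number by at most one, and fewer than \<open>h\<close>
  positions from the start it is 0.\<close>

lemma run_profile_mult_le:
  assumes "run_profile h k n r" "p < n"
  shows "h * r p \<le> p"
  using assms(2)
proof (induction p rule: less_induct)
  case (less p)
  show ?case
  proof (cases "p < h \<or> h = 0")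
    case True
    then show ?thesis using assms(1) less.prems by (auto simp: run_profile_def)
  next
    case False
    have "r p \<le> Suc (r (p - h))"
      using assms(1) less.prems False by (auto simp: run_profile_def)
    then have "h * r p \<le> h * Suc (r (p - h))" by (rule mult_le_mono2)
    moreover have "h * r (p - h) \<le> p - h" using less False by auto
    ultimately show ?thesis using False by (auto simp: not_less)
  qed
qed

lemma run_profile_less:
  assumes "run_profile h k n r" "h \<ge> 1" "p < n"
  shows "r p < k"
proof -
  have "r p \<le> r (n - 1)" "Suc (r (n - 1)) = k"
    using assms by (auto simp: run_profile_def)
  then show ?thesis by simp
qed

lemma starts_of_run_profile:
  assumes r: "run_profile h k n r" and hk: "h \<ge> 1" "k \<ge> 1" and n: "n \<ge> 1"
  obtains B where "run_starts h k B" "B k = n" "stacked_runs h k B = cell h k r ` {..<n}"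
proof
  define B where "B s = card {p. p < n \<and> r p < s}" for s
  have mono: "r u \<le> r v" if "u \<le> v" "v < n" for u v
    using r that by (auto simp: run_profile_def)
  have less: "r p < k" if "p < n" for p using run_profile_less[OF r] that hk by simp
  have B_iff: "p < B s \<longleftrightarrow> r p < s" if p: "p < n" for p s
  proof
    assume "r p < s"
    then have "{..p} \<subseteq> {p. p < n \<and> r p < s}" using mono p by fastforce
    then have "card {..p} \<le> B s" unfolding B_def by (intro card_mono) auto
    then show "p < B s" by simp
  next
    assume lt: "p < B s"
    show "r p < s"
    proof (rule ccontr)
      assume "\<not> r p < s"
      then have "{q. q < n \<and> r q < s} \<subseteq> {..<p}"
        using mono[of p] by (auto intro: ccontr) (meson le_less_trans not_less)
      then have "B s \<le> card {..<p}" unfolding B_def by (intro card_mono) auto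
      with lt show False by simp
    qed
  qed
  have B_le: "B s \<le> n" for s
    using card_mono[of "{..<n}" "{p. p < n \<and> r p < s}"] by (auto simp: B_def)
  show Bk: "B k = n" using less by (simp add: B_def cong: conj_cong)
  have B0: "B 0 = 0" by (simp add: B_def)
  have gap: "B s + h \<le> B (Suc s)" if s: "s < k" "k > 1" for s
  proof (cases "B s")
    case 0
    \<comment> \<open>No position lies in a run before \<open>s\<close>, so run \<open>s\<close> contains the first \<open>h\<close> positions.\<close>
    have "h \<le> n"
    proof (rule ccontr)
      assume "\<not> h \<le> n"
      then have "r 0 = 0" "Suc (r 0) = k" using r n by (auto simp: run_profile_def)
      then show False using s by simp
    qed
    then have "r (h - 1) = 0" using r hk by (auto simp: run_profile_def)
    then have "h - 1 < B (Suc s)" using B_iff[of "h - 1" "Suc s"] \<open>h \<le> n\<close> hk by simp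
    then show ?thesis using 0 by simp
  next
    \<comment> \<open>\<open>q\<close> is the last position before run \<open>s\<close>; one step by \<open>h\<close> from it cannot pass that run.\<close>
    case (Suc q)
    have q: "q < n" using Suc B_le[of s] by simp
    then have rq: "r q < s" using B_iff[of q s] Suc by simp
    have "q + h < n"
    proof (rule ccontr)
      assume "\<not> q + h < n"
      then have "Suc (r q) = k" using r q by (auto simp: run_profile_def)
      then show False using rq s by simp
    qed
    moreover from this have "r (q + h) \<le> Suc (r q)" using r by (auto simp: run_profile_def)
    ultimately have "q + h < B (Suc s)" using B_iff[of "q + h" "Suc s"] rq by simp
    then show ?thesis using Suc by simp
  qed
  have "B s < B (Suc s)" if s: "s < k" for s
  proof (cases "k > 1")
    case True
    then show ?thesis using gap s hk by fastforce
  next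
    case False
    then have "k = 1" "s = 0" using s by auto
    then show ?thesis using B0 Bk n by simp
  qed
  then show "run_starts h k B" using gap B0 by (simp add: run_starts_def)
  show "stacked_runs h k B = cell h k r ` {..<n}"
  proof (intro equalityI subsetI)
    fix c assume "c \<in> stacked_runs h k B"
    then obtain s p where sp: "s < k" "B s \<le> p" "p < B (Suc s)" "c = (k - Suc s, p - h * s)"
      by (auto simp: stacked_runs_def)
    have p: "p < n" using B_le[of "Suc s"] sp by simp
    then have "r p = s" using B_iff[OF p, of s] B_iff[OF p, of "Suc s"] sp by simp
    then show "c \<in> cell h k r ` {..<n}" using p sp by (auto simp: cell_def)
  next
    fix c assume "c \<in> cell h k r ` {..<n}"
    then obtain p where p: "p < n" "c = cell h k r p" by auto
    then have "B (r p) \<le> p" "p < B (Suc (r p))" using B_iff[of p "r p"] B_iff[of p "Suc (r p)"] by auto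
    then show "c \<in> stacked_runs h k B"
      using p less[of p] by (auto simp: cell_def stacked_runs_def)
  qed
qed

text \<open>The position of a cell in the reading word depends on \<open>h\<close> and \<open>k\<close> only, not on the shape.
  This is why words with the same tableau are equal.\<close>

definition position :: "nat \<Rightarrow> nat \<Rightarrow> nat \<times> nat \<Rightarrow> nat" where
  "position h k = (\<lambda>(i, j). j + h * (k - Suc i))"

lemma position_cell:
  assumes "run_profile h k n r" "h \<ge> 1" "p < n"
  shows "position h k (cell h k r p) = p"
proof -
  have "k - Suc (k - Suc (r p)) = r p" using run_profile_less[OF assms] by simp
  then show ?thesis using run_profile_mult_le[OF assms(1,3)] by (simp add: position_def cell_def)
qed

lemma inj_on_cell: "run_profile h k n r \<Longrightarrow> h \<ge> 1 \<Longrightarrow> inj_on (cell h k r) {..<n}"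
  by (rule inj_on_inverseI[where g = "position h k"]) (simp add: position_cell)

lemma shape_iff_run_profile:
  assumes hk: "h \<ge> 1" "k \<ge> 1" and n: "n \<ge> 1"
  shows "skew_shape k S \<and> card S = n \<and>
      (\<forall>i. Suc i < k \<longrightarrow> card (common_columns S i (Suc i)) = h)
    \<longleftrightarrow> (\<exists>r. run_profile h k n r \<and> S = cell h k r ` {..<n})" (is "?L \<longleftrightarrow> ?R")
proof
  assume L: ?L
  then obtain B where B: "run_starts h k B" "S = stacked_runs h k B"
    using overlapping_shape_iff[OF hk] by blast
  obtain r where r: "run_profile h k (B k) r" "S = cell h k r ` {..<B k}"
    using run_profile_of_starts[OF B(1) hk(2)] B(2) by blast
  have "B k = n" using L r inj_on_cell[OF r(1) hk(1)] by (simp add: card_image)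
  then show ?R using r by blast
next
  assume ?R
  then obtain r where r: "run_profile h k n r" "S = cell h k r ` {..<n}" by blast
  obtain B where B: "run_starts h k B" "stacked_runs h k B = S"
    using starts_of_run_profile[OF r(1) hk n] r(2) by metis
  have "card S = n" using r inj_on_cell[OF r(1) hk(1)] by (simp add: card_image)
  moreover have "skew_shape k S \<and> (\<forall>i. Suc i < k \<longrightarrow> card (common_columns S i (Suc i)) = h)"
    unfolding overlapping_shape_iff[OF hk] using B by blast
  ultimately show ?L by blast
qed

section \<open>Fillings\<close>

lemma layered_run_decreasing:
  assumes r: "run_profile h k (length xs) r" and "layered h r xs" and "h \<ge> 1"
    and "u < v" "v < length xs" "r v = r u"
  shows "xs ! v < xs ! u"
  using assms(4-6)
proof (induction v rule: less_induct)
  case (less v)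
  then obtain w where v: "v = Suc w" by (cases v) auto
  have mono: "r a \<le> r b" if "a \<le> b" "b < length xs" for a b
    using r that by (auto simp: run_profile_def)
  have "r u \<le> r w" "r w \<le> r v" using less.prems v mono[of u w] mono[of w v] by simp_all
  then have rw: "r w = r u" using less.prems by simp
  have step: "xs ! v < xs ! w"
    using assms(2,3) less.prems rw v by (auto simp: layered_def)
  show ?case
  proof (cases "w = u")
    case False
    then have "xs ! w < xs ! u" using less rw v by simp
    then show ?thesis using step by simp
  qed (use step in simp)
qed

text \<open>The cells above the cell of position \<open>u\<close> in its column have positions \<open>u + h\<close>,
  \<open>u + 2 * h\<close>, and so on. If \<open>u + h * m\<close> is \<open>m\<close> runs further on, then each of the \<open>m\<close> steps by
  \<open>h\<close> enters the next run, because no step can enter a later one.\<close>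

lemma layered_column_increasing:
  assumes r: "run_profile h k (length xs) r" and "layered h r xs" and "h \<ge> 1" and "distinct xs"
    and "m > 0" "u + h * m < length xs" "r (u + h * m) = r u + m"
  shows "xs ! u < xs ! (u + h * m)"
proof -
  have jump: "r (w + h) \<le> Suc (r w)" if "w + h < length xs" for w
    using r that by (auto simp: run_profile_def)
  have bound: "r (u + h * m) \<le> r u + m" if "u + h * m < length xs" for m
    using that
  proof (induction m)
    case (Suc m)
    then have "r (u + h * m + h) \<le> Suc (r (u + h * m))"
      by (intro jump) (simp add: algebra_simps)
    with Suc show ?case by (simp add: algebra_simps)
  qed simp
  show ?thesis
    using assms(5-7)
  proof (induction m)
    case (Suc m)
    define w where "w = u + h * m"
    have next_w: "u + h * Suc m = w + h" by (simp add: w_def)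
    have w: "w + h < length xs" using Suc.prems next_w by simp
    have rw: "r w = r u + m"
      using bound[of m] jump[OF w] Suc.prems(3) w unfolding next_w w_def by simp
    have "r (w + h) \<noteq> r w" using Suc.prems(3) rw unfolding next_w by simp
    then have "\<not> xs ! (w + h) < xs ! w"
      using assms(2,3) w by (auto simp: layered_def)
    moreover have "xs ! (w + h) \<noteq> xs ! w"
      using assms(3,4) w by (simp add: nth_eq_iff_index_eq)
    ultimately have step: "xs ! w < xs ! (w + h)" by simp
    show ?case
    proof (cases "m = 0")
      case True
      then show ?thesis using step by (simp add: w_def)
    next
      case False
      then have "xs ! u < xs ! w" using Suc.IH rw w by (simp add: w_def)
      then show ?thesis using step unfolding next_w by simp
    qed
  qed simp
qed

text \<open>For the direction from the filling to \<open>layered\<close>, let \<open>v\<close> be in the run after that of \<open>u\<close>,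
  at distance at most \<open>h\<close>. The cell below that of \<open>v\<close> has position \<open>v - h\<close>, which lies in the run
  of \<open>u\<close> and not to the right of \<open>u\<close>. So the entry at \<open>v\<close> exceeds the one at \<open>v - h\<close> by the
  column condition, and that one is at least the entry at \<open>u\<close> by the row condition.\<close>

lemma decreasing_filling_iff_layered:
  assumes r: "run_profile h k n r" and h: "h \<ge> 1" and len: "length xs = n" and dist: "distinct xs"
    and S: "S = cell h k r ` {..<n}" and T: "\<And>p. p < n \<Longrightarrow> T (cell h k r p) = xs ! p"
  shows "(\<forall>i j j'. (i, j) \<in> S \<longrightarrow> (i, j') \<in> S \<longrightarrow> j < j' \<longrightarrow> T (i, j) > T (i, j')) \<and>
      (\<forall>i i' j. (i, j) \<in> S \<longrightarrow> (i', j) \<in> S \<longrightarrow> i < i' \<longrightarrow> T (i, j) > T (i', j))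
    \<longleftrightarrow> layered h r xs" (is "?rows \<and> ?cols \<longleftrightarrow> _")
proof
  note less = run_profile_less[OF r h] and mult_le = run_profile_mult_le[OF r]
  have cellE: thesis if "(i, j) \<in> S"
    "\<And>p. p < n \<Longrightarrow> i = k - Suc (r p) \<Longrightarrow> j = p - h * r p \<Longrightarrow> T (i, j) = xs ! p \<Longrightarrow> thesis"
    for i j thesis
    using that T unfolding S cell_def by force
  assume lay: "layered h r xs"
  show "?rows \<and> ?cols"
  proof (intro conjI allI impI)
    fix i j j' assume "(i, j) \<in> S" "(i, j') \<in> S" "j < j'"
    then obtain p p' where p: "p < n" "i = k - Suc (r p)" "j = p - h * r p" "T (i, j) = xs ! p"
      and p': "p' < n" "i = k - Suc (r p')" "j' = p' - h * r p'" "T (i, j') = xs ! p'"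
      by (metis cellE)
    have "r p' = r p" using p p' less[of p] less[of p'] by simp
    moreover from this have "p < p'" using p p' \<open>j < j'\<close> by simp
    ultimately have "xs ! p' < xs ! p"
      using layered_run_decreasing[of h k xs r p p'] r lay h len p' by simp
    then show "T (i, j') < T (i, j)" using p p' by simp
  next
    fix i i' j assume "(i, j) \<in> S" "(i', j) \<in> S" "i < i'"
    then obtain p p' where p: "p < n" "i = k - Suc (r p)" "j = p - h * r p" "T (i, j) = xs ! p"
      and p': "p' < n" "i' = k - Suc (r p')" "j = p' - h * r p'" "T (i', j) = xs ! p'"
      by (metis cellE)
    define m where "m = r p - r p'"
    have "r p' < r p" using p(2) p'(2) \<open>i < i'\<close> by linarith
    then have rp: "r p = r p' + m" and m: "m > 0" by (simp_all add: m_def)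
    have "p = p' + h * m"
      using p p' mult_le[of p] mult_le[of p'] unfolding rp by (simp add: algebra_simps)
    then have "xs ! p' < xs ! p"
      using layered_column_increasing[of h k xs r m p'] r lay h len dist m rp p by simp
    then show "T (i', j) < T (i, j)" using p p' by simp
  qed
next
  note less = run_profile_less[OF r h] and mult_le = run_profile_mult_le[OF r]
  have in_S: "cell h k r p \<in> S" if "p < n" for p using that S by simp
  assume filling: "?rows \<and> ?cols"
  have row: "xs ! v < xs ! u" if "u < v" "v < n" "r v = r u" for u v
  proof -
    have "u - h * r u < v - h * r u" using mult_le[of u] that by simp
    then have "T (cell h k r v) < T (cell h k r u)"
      using filling in_S[of u] in_S[of v] that unfolding cell_def by simp
    then show ?thesis using T that by simp
  qed
  have column: "xs ! u < xs ! (u + h)" if "u + h < n" "r (u + h) = Suc (r u)" for u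
  proof -
    have "u + h - h * Suc (r u) = u - h * r u" by simp
    moreover have "k - Suc (Suc (r u)) < k - Suc (r u)" using less[of "u + h"] that by simp
    ultimately have "T (cell h k r u) < T (cell h k r (u + h))"
      using filling in_S[of u] in_S[of "u + h"] that unfolding cell_def by simp
    then show ?thesis using T that by simp
  qed
  show "layered h r xs"
    unfolding layered_def len
  proof (intro allI impI)
    fix u v assume uv: "u < v" "v \<le> u + h" "v < n"
    show "xs ! v < xs ! u \<longleftrightarrow> r v = r u"
    proof
      assume "r v = r u"
      then show "xs ! v < xs ! u" using row uv by simp
    next
      assume desc: "xs ! v < xs ! u"
      show "r v = r u"
      proof (rule ccontr)
        assume "r v \<noteq> r u"
        moreover have "r u \<le> r v" "r v \<le> Suc (r u)" using r uv by (auto simp: run_profile_def)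
        ultimately have rv: "r v = Suc (r u)" by simp
        then have "\<not> v < h" using r uv by (auto simp: run_profile_def)
        then obtain w where w: "v = w + h" by (metis add.commute le_Suc_ex not_less)
        then have "w \<le> u" using uv by simp
        moreover have "r v \<le> Suc (r w)" "r w \<le> r u"
          using r w uv by (auto simp: run_profile_def)
        ultimately have rw: "r w = r u" using rv by simp
        have "xs ! w < xs ! v" using column[of w] rw rv w uv by simp
        moreover have "xs ! u \<le> xs ! w"
          using row[of w u] rw \<open>w \<le> u\<close> uv by (cases "w = u") auto
        ultimately show False using desc by simp
      qed
    qed
  qed
qed

section \<open>The bijection\<close>

definition tableau_of_word ::
  "nat \<Rightarrow> nat \<Rightarrow> nat list \<Rightarrow> (nat \<times> nat) set \<times> (nat \<times> nat \<Rightarrow> nat)" where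
  "tableau_of_word h k xs =
     (let S = cell h k (run_index xs) ` {..<length xs}
      in (S, restrict (\<lambda>c. xs ! position h k c) S))"

lemma tableau_of_word_in_SkYT:
  assumes h: "h \<ge> 1" and k: "k \<ge> 1" and n: "n \<ge> 1"
    and xs: "xs \<in> permutations_of_set {1..n}"
    and r: "run_profile h k n (run_index xs)" and lay: "layered h (run_index xs) xs"
  shows "tableau_of_word h k xs \<in> SkYT h n k"
proof -
  define S where "S = cell h k (run_index xs) ` {..<n}"
  define T where "T = restrict (\<lambda>c. xs ! position h k c) S"
  have set_xs: "set xs = {1..n}" and dist: "distinct xs"
    using xs by (simp_all add: permutations_of_set_def)
  have len: "length xs = n" using length_finite_permutations_of_set[OF xs] by simp
  have T_cell: "T (cell h k (run_index xs) p) = xs ! p" if "p < n" for p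
    using that position_cell[OF r h that] by (simp add: T_def S_def)
  have "bij_betw (\<lambda>p. T (cell h k (run_index xs) p)) {..<n} {1..n}"
    using bij_betw_nth[OF dist, of "{..<n}" "{1..n}"] len set_xs T_cell
    by (metis (no_types, lifting) bij_betw_cong lessThan_iff)
  then have "bij_betw T S {1..n}"
    using bij_betw_comp_iff[of "cell h k (run_index xs)" "{..<n}" S T "{1..n}"] inj_on_cell[OF r h]
    by (simp add: S_def bij_betw_def[of "cell h k (run_index xs)"] comp_def)
  moreover have "T \<in> extensional S" by (simp add: T_def)
  ultimately have "tableau_filling n S T"
    using decreasing_filling_iff_layered[OF r h len dist S_def T_cell] lay
    by (simp add: tableau_filling_def)
  moreover have "skew_shape k S \<and> card S = n \<and>
      (\<forall>i. Suc i < k \<longrightarrow> card (common_columns S i (Suc i)) = h)"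
    unfolding shape_iff_run_profile[OF h k n] using r S_def by blast
  moreover have "tableau_of_word h k xs = (S, T)"
    by (simp add: tableau_of_word_def S_def T_def len Let_def)
  ultimately show ?thesis by (simp add: SkYT_def)
qed

lemma tableau_of_word_eqD:
  assumes h: "h \<ge> 1" and len: "length xs = n" "length ys = n"
    and xs: "run_profile h k n (run_index xs)" and ys: "run_profile h k n (run_index ys)"
    and eq: "tableau_of_word h k xs = tableau_of_word h k ys"
  shows "xs = ys"
proof (rule nth_equalityI)
  fix p assume "p < length xs"
  then have p: "p < n" using len by simp
  let ?c = "cell h k (run_index xs) p"
  have S: "cell h k (run_index xs) ` {..<n} = cell h k (run_index ys) ` {..<n}"
    and T: "restrict (\<lambda>c. xs ! position h k c) (cell h k (run_index xs) ` {..<n})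
      = restrict (\<lambda>c. ys ! position h k c) (cell h k (run_index ys) ` {..<n})"
    using eq[unfolded tableau_of_word_def Let_def len prod.inject] by (rule conjunct1, rule conjunct2)
  have "?c \<in> cell h k (run_index xs) ` {..<n}" using p by simp
  then have "xs ! position h k ?c = ys ! position h k ?c"
    using fun_cong[OF T, of ?c] S by simp
  then show "xs ! p = ys ! p" using position_cell[OF xs h p] by simp
qed (use len in simp)

text \<open>A profile for which the word is layered consists of the run numbers of that word: it grows
  precisely where the word does not descend. So the shape of a tableau can be recovered from its
  reading word.\<close>

lemma layered_run_index_eq:
  assumes r: "run_profile h k (length xs) r" and lay: "layered h r xs" and h: "h \<ge> 1"
    and "p < length xs"
  shows "run_index xs p = r p"
  using assms(4)
proof (induction p)
  case 0
  then show ?case using r h by (auto simp: run_profile_def)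
next
  case (Suc p)
  have "r p \<le> r (Suc p)" "r (Suc p) \<le> Suc (r p)"
    using r h Suc.prems by (auto simp: run_profile_def)
  moreover have "xs ! Suc p < xs ! p \<longleftrightarrow> r (Suc p) = r p"
    using lay h Suc.prems by (auto simp: layered_def)
  ultimately show ?case using Suc by (auto simp: run_index_Suc)
qed

lemma run_profile_cong:
  "(\<And>p. p < n \<Longrightarrow> r p = r' p) \<Longrightarrow> run_profile h k n r \<longleftrightarrow> run_profile h k n r'"
  by (auto simp: run_profile_def)

lemma layered_cong:
  "(\<And>p. p < length xs \<Longrightarrow> r p = r' p) \<Longrightarrow> layered h r xs \<longleftrightarrow> layered h r' xs"
  by (auto simp: layered_def)

lemma SkYT_imp_tableau_of_word:
  assumes h: "h \<ge> 1" and k: "k \<ge> 1" and n: "n \<ge> 1" and ST: "(S, T) \<in> SkYT h n k"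
  obtains xs where "xs \<in> permutations_of_set {1..n}" "run_profile h k n (run_index xs)"
    "layered h (run_index xs) xs" "tableau_of_word h k xs = (S, T)"
proof -
  have T: "tableau_filling n S T" using ST by (simp add: SkYT_def)
  obtain r where r: "run_profile h k n r" and S: "S = cell h k r ` {..<n}"
    using ST shape_iff_run_profile[OF h k n, of S] by (auto simp: SkYT_def)
  define xs where "xs = map (\<lambda>p. T (cell h k r p)) [0..<n]"
  have len: "length xs = n" by (simp add: xs_def)
  have T_cell: "T (cell h k r p) = xs ! p" if "p < n" for p
    using that by (simp add: xs_def)
  have "bij_betw (cell h k r) {..<n} S"
    using inj_on_cell[OF r h] S by (simp add: bij_betw_def)
  then have bij: "bij_betw (\<lambda>p. T (cell h k r p)) {..<n} {1..n}"
    using T bij_betw_trans[of "cell h k r" _ S T] by (simp add: tableau_filling_def comp_def)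
  then have dist: "distinct xs"
    by (simp add: xs_def distinct_map bij_betw_def lessThan_atLeast0)
  have "set xs = {1..n}"
    using bij by (simp add: xs_def bij_betw_def lessThan_atLeast0)
  with dist have perm: "xs \<in> permutations_of_set {1..n}" by (rule permutations_of_setI[rotated])
  have lay: "layered h r xs"
    using decreasing_filling_iff_layered[OF r h len dist S T_cell] T
    by (simp add: tableau_filling_def)
  have idx: "run_index xs p = r p" if "p < n" for p
    using layered_run_index_eq[of h k xs r p] r lay h len that by simp
  have "run_profile h k n (run_index xs)" using run_profile_cong[of n "run_index xs" r] idx r by simp
  moreover have "layered h (run_index xs) xs" using layered_cong[of xs "run_index xs" r] idx lay len by simp
  moreover have "tableau_of_word h k xs = (S, T)"
  proof -
    have S': "cell h k (run_index xs) ` {..<n} = S"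
      unfolding S by (intro image_cong) (simp_all add: cell_def idx)
    have "restrict (\<lambda>c. xs ! position h k c) S = T"
    proof (rule extensionalityI)
      show "T \<in> extensional S" using T by (simp add: tableau_filling_def)
      fix c assume "c \<in> S"
      then obtain p where "p < n" "c = cell h k r p" using S by auto
      then show "restrict (\<lambda>c. xs ! position h k c) S c = T c"
        using T_cell position_cell[OF r h] \<open>c \<in> S\<close> by simp
    qed simp
    then show ?thesis using S' by (simp add: tableau_of_word_def Let_def len)
  qed
  ultimately show thesis using that perm by blast
qed

theorem theorem5p1:
  fixes h k d :: nat
  assumes "h \<ge> 1" and "k \<ge> 1"
  shows "\<exists>f. bij_betw f (SkYT h (d + k) k)
              {xs \<in> permutations_of_set {1..d + k}. des xs = d \<and> DES h d xs}"
proof -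
  let ?P = "{xs \<in> permutations_of_set {1..d + k}. des xs = d \<and> DES h d xs}"
  have len: "length xs = d + k" if "xs \<in> permutations_of_set {1..d + k}" for xs
    using length_finite_permutations_of_set[OF that] by simp
  have des: "des xs = d" if "length xs = d + k" "run_profile h k (d + k) (run_index xs)" for xs
  proof -
    have "Suc (run_index xs (d + k - 1)) = k"
      using that(2) assms by (auto simp: run_profile_def)
    moreover have "xs \<noteq> []" using that(1) assms by auto
    ultimately show ?thesis using run_index_last[of xs] that(1) by simp
  qed
  define Q where "Q = {xs \<in> permutations_of_set {1..d + k}.
      run_profile h k (d + k) (run_index xs) \<and> layered h (run_index xs) xs}"
  have P: "?P = Q"
    unfolding Q_def
    using DES_iff_run_profile[OF len _ assms] des len by blast
  have "bij_betw (tableau_of_word h k) ?P (SkYT h (d + k) k)"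
    unfolding P bij_betw_def
  proof (intro conjI inj_onI equalityI subsetI)
    fix xs ys
    assume "xs \<in> Q" "ys \<in> Q" "tableau_of_word h k xs = tableau_of_word h k ys"
    then show "xs = ys" using tableau_of_word_eqD[OF assms(1) len len] unfolding Q_def by blast
  next
    fix ST
    assume "ST \<in> tableau_of_word h k ` Q"
    then show "ST \<in> SkYT h (d + k) k"
      using tableau_of_word_in_SkYT[OF assms, of "d + k"] assms(2) by (auto simp: Q_def)
  next
    fix ST
    assume "ST \<in> SkYT h (d + k) k"
    moreover obtain S T where "ST = (S, T)" by (cases ST)
    moreover have "d + k \<ge> 1" using assms by simp
    ultimately show "ST \<in> tableau_of_word h k ` Q"
      using SkYT_imp_tableau_of_word[OF assms, of "d + k" S T]
      by (metis (mono_tags, lifting) CollectI Q_def image_eqI)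
  qed
  then show ?thesis using bij_betw_inv by blast
qed

end
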